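(* Let $K$ be a field of characteristic zero. For arbitrary binary quadratic forms $U,V,W$ and an arbitrary linear form $a_{\mathbf{x}}$ in the variables $x_1,x_2$ with coefficients in $K$, one has the identity $$\bigl(U,\,(V,a_{\mathbf{x}})_1\,(W,a_{\mathbf{x}})_1\bigr)_1=(M,a_{\mathbf{x}}^2)_2+(N,a_{\mathbf{x}}^2)_1,$$ where $$M=\tfrac12\,(U,W)_1\,V+\tfrac12\,(U,V)_1\,W,\qquad N=-\tfrac12\,(U,VW)_2-\tfrac16\,U\,(V,W)_2.$$
   Context: Transvectants: for binary forms $G,H$ in $x_1,x_2$ regarded as forms of degrees $m,n$ and an integer $r\ge 0$ with $r\le m,n$, the $r$-th transvectant is $$(G,H)_r=\frac{(m-r)!\,(n-r)!}{m!\,n!}\sum_{i=0}^r(-1)^i\binom{r}{i}\frac{\partial^rG}{\partial x_1^{r-i}\partial x_2^{i}}\,\frac{\partial^rH}{\partial x_1^{i}\partial x_2^{r-i}},$$ a form of degree $m+n-2r$ (or zero). In the claim, $U,V,W,a_{\mathbf{x}}^2,N$ have degree 2, $a_{\mathbf{x}},(V,a_{\mathbf{x}})_1,(W,a_{\mathbf{x}})_1$ have degree 1, $VW$ and $M$ have degree 4, and $(V,W)_2$ is a scalar. *)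

theory Defs
  imports "HOL-Computational_Algebra.Polynomial"
begin

text \<open>
  Polynomials in \<open>x\<^sub>1, x\<^sub>2\<close> over \<open>K\<close> are elements of \<open>K[x\<^sub>1][x\<^sub>2]\<close>: the inner variable is
  \<open>x\<^sub>1\<close>, the outer one is \<open>x\<^sub>2\<close>, so \<open>coeff (coeff F j) i\<close> is the coefficient of
  \<open>x\<^sub>1\<^sup>i x\<^sub>2\<^sup>j\<close> in \<open>F\<close>, and a scalar \<open>c\<close> is \<open>[:[:c:]:]\<close>.
\<close>

type_synonym 'a bipoly = "'a poly poly"

text \<open>The zero polynomial counts as a form of every degree.\<close>

definition binary_form :: "nat \<Rightarrow> 'a::zero bipoly \<Rightarrow> bool" where
  "binary_form d F \<longleftrightarrow> (\<forall>i j. coeff (coeff F j) i \<noteq> 0 \<longrightarrow> i + j = d)"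

definition scale :: "'a::comm_semiring_0 \<Rightarrow> 'a bipoly \<Rightarrow> 'a bipoly" where
  "scale c F = smult [:c:] F"

definition dx1 :: "'a::field bipoly \<Rightarrow> 'a bipoly" where
  "dx1 F = map_poly pderiv F"

definition dx2 :: "'a::field bipoly \<Rightarrow> 'a bipoly" where
  "dx2 F = pderiv F"

text \<open>
  \<open>transvectant m n r G H\<close> is \<open>(G, H)\<^sub>r\<close> with \<open>G\<close>, \<open>H\<close> regarded as forms of degrees \<open>m\<close>, \<open>n\<close>;
  the degrees are explicit because \<open>G\<close> or \<open>H\<close> may vanish.
  It is meaningful only for \<open>r \<le> m\<close> and \<open>r \<le> n\<close> (truncated subtraction).
\<close>

definition transvectant ::
    "nat \<Rightarrow> nat \<Rightarrow> nat \<Rightarrow> 'a::field_char_0 bipoly \<Rightarrow> 'a bipoly \<Rightarrow> 'a bipoly" where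
  "transvectant m n r G H =
     scale (fact (m - r) * fact (n - r) / (fact m * fact n))
       (\<Sum>i\<le>r. scale ((-1) ^ i * of_nat (r choose i))
          ((dx1 ^^ (r - i)) ((dx2 ^^ i) G) * (dx1 ^^ i) ((dx2 ^^ (r - i)) H)))"

end

theory Submission
  imports Defs
begin

text \<open>
  The identity is checked on coefficients. With the coefficients normalised by binomial factors, as below, the transvectants of forms of
  low degree become short bilinear expressions, and comparing coefficients leaves three
  polynomial identities in the coefficients of \<open>U\<close>, \<open>V\<close>, \<open>W\<close> and \<open>a\<close>.
\<close>

definition linear_form :: "'a::field_char_0 \<Rightarrow> 'a \<Rightarrow> 'a bipoly" where
  "linear_form p q = [:[:0, p:], [:q:]:]"

definition quadratic_form :: "'a::field_char_0 \<Rightarrow> 'a \<Rightarrow> 'a \<Rightarrow> 'a bipoly" where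
  "quadratic_form a b c = [:[:0, 0, a:], [:0, 2 * b:], [:c:]:]"

definition quartic_form ::
    "'a::field_char_0 \<Rightarrow> 'a \<Rightarrow> 'a \<Rightarrow> 'a \<Rightarrow> 'a \<Rightarrow> 'a bipoly" where
  "quartic_form a b c d e =
     [:[:0, 0, 0, 0, a:], [:0, 0, 0, 4 * b:], [:0, 0, 6 * c:], [:0, 4 * d:], [:e:]:]"

lemmas form_defs = linear_form_def quadratic_form_def quartic_form_def

lemma binary_form_coeff_eq_0:
  "binary_form d F \<Longrightarrow> i + j \<noteq> d \<Longrightarrow> coeff (coeff F j) i = 0"
  unfolding binary_form_def by blast

lemma binary_form_1_cases:
  assumes "binary_form 1 F"
  obtains p q where "F = linear_form p q"
proof
  show "F = linear_form (coeff (coeff F 0) 1) (coeff (coeff F 1) 0)"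
    unfolding linear_form_def
    by (intro poly_eqI)
      (auto simp: coeff_pCons binary_form_coeff_eq_0[OF assms] split: nat.split)
qed

lemma binary_form_2_cases:
  assumes "binary_form 2 F"
  obtains a b c where "F = quadratic_form a b c"
proof
  \<comment> \<open>Halving the mixed coefficient, legitimate in characteristic zero, undoes the
    factor 2 built into \<open>quadratic_form\<close>.\<close>
  show "F = quadratic_form (coeff (coeff F 0) 2) (coeff (coeff F 1) 1 / 2) (coeff (coeff F 2) 0)"
    unfolding quadratic_form_def
    by (intro poly_eqI)
      (auto simp: coeff_pCons numeral_2_eq_2 binary_form_coeff_eq_0[OF assms] split: nat.split)
qed

lemma dx1_0 [simp]: "dx1 0 = 0"
  by (simp add: dx1_def)

lemma dx1_pCons [simp]: "dx1 (pCons f F) = pCons (pderiv f) (dx1 F)"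
  by (simp add: dx1_def map_poly_pCons)

lemma dx2_0 [simp]: "dx2 0 = 0"
  by (simp add: dx2_def)

lemma dx2_pCons [simp]: "dx2 (pCons f F) = F + pCons 0 (dx2 F)"
  by (simp add: dx2_def pderiv_pCons)

lemma scale_1 [simp]: "scale 1 F = F" for F :: "'a::comm_semiring_1 bipoly"
  by (simp add: scale_def flip: one_pCons)

lemma scale_minus [simp]: "scale (- c) F = - scale c F" for c :: "'a::comm_ring"
  using smult_minus_left[of "[:c:]" F] by (simp add: scale_def)

text \<open>The sum for r = 1 is the Jacobian determinant of \<open>G\<close> and \<open>H\<close>;
  the degrees enter only through the scalar in front.\<close>

lemma transvectant_1:
  "transvectant m n 1 G H =
     scale (fact (m - 1) * fact (n - 1) / (fact m * fact n)) (dx1 G * dx2 H - dx2 G * dx1 H)"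
  by (simp add: transvectant_def atMost_Suc)

text \<open>The sum for r = 2 is the polarised Hessian: for \<open>G\<close> = \<open>H\<close> it
  is twice the Hessian determinant.\<close>

lemma transvectant_2:
  "transvectant m n 2 G H =
     scale (fact (m - 2) * fact (n - 2) / (fact m * fact n))
       (dx1 (dx1 G) * dx2 (dx2 H) - scale 2 (dx1 (dx2 G) * dx1 (dx2 H)) + dx2 (dx2 G) * dx1 (dx1 H))"
  by (simp add: transvectant_def eval_nat_numeral atMost_Suc add.commute)

lemma mult_linear_linear:
  "linear_form p q * linear_form r s = quadratic_form (p * r) ((p * s + q * r) / 2) (q * s)"
  by (simp add: form_defs field_simps)

text \<open>The denominators come from dividing the ordinary product coefficients by the binomial
  coefficients 4, 6, 4.\<close>

lemma mult_quadratic_quadratic: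
  "quadratic_form a b c * quadratic_form a' b' c' =
     quartic_form (a * a') ((a * b' + b * a') / 2) ((a * c' + 4 * b * b' + c * a') / 6)
       ((b * c' + c * b') / 2) (c * c')"
  by (simp add: form_defs field_simps)

text \<open>Serves the term U (V,W)_2 of \<open>N\<close>, whose second factor is a constant
  polynomial.\<close>

lemma mult_quadratic_scalar:
  "quadratic_form a b c * [:[:k:]:] = quadratic_form (a * k) (b * k) (c * k)"
  by (simp add: form_defs field_simps)

lemma scale_quadratic: "scale k (quadratic_form a b c) = quadratic_form (k * a) (k * b) (k * c)"
  by (simp add: form_defs scale_def)

lemma scale_quartic:
  "scale k (quartic_form a b c d e) = quartic_form (k * a) (k * b) (k * c) (k * d) (k * e)"
  by (simp add: form_defs scale_def)

lemma add_quadratic: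
  "quadratic_form a b c + quadratic_form a' b' c' = quadratic_form (a + a') (b + b') (c + c')"
  by (simp add: form_defs algebra_simps)

lemma minus_quadratic: "- quadratic_form a b c = quadratic_form (- a) (- b) (- c)"
  by (simp add: form_defs)

lemma diff_quadratic:
  "quadratic_form a b c - quadratic_form a' b' c' = quadratic_form (a - a') (b - b') (c - c')"
  by (simp add: form_defs algebra_simps)

lemma add_quartic:
  "quartic_form a b c d e + quartic_form a' b' c' d' e' =
     quartic_form (a + a') (b + b') (c + c') (d + d') (e + e')"
  by (simp add: form_defs algebra_simps)

lemma transvectant_quadratic_linear:
  "transvectant 2 1 1 (quadratic_form a b c) (linear_form p q) =
     linear_form (a * q - b * p) (b * q - c * p)"
  unfolding transvectant_1 by (simp add: scale_def form_defs pderiv_pCons field_simps)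

lemma transvectant_1_quadratic_quadratic:
  "transvectant 2 2 1 (quadratic_form a b c) (quadratic_form a' b' c') =
     quadratic_form (a * b' - b * a') ((a * c' - c * a') / 2) (b * c' - c * b')"
  unfolding transvectant_1 by (simp add: scale_def form_defs pderiv_pCons field_simps)

text \<open>This is the apolar pairing, the polarisation of the discriminant 2(ac - b^2).\<close>

lemma transvectant_2_quadratic_quadratic:
  "transvectant 2 2 2 (quadratic_form a b c) (quadratic_form a' b' c') =
     [:[:a * c' - 2 * b * b' + c * a':]:]"
  unfolding transvectant_2 by (simp add: scale_def form_defs pderiv_pCons field_simps)

text \<open>The second derivatives of the quartic are 12 times the quadratics with normalised
  coefficients (p,q,r), (q,r,s), (r,s,t). Each resulting coefficient is therefore the apolar pairing
  with one of these triples, and the prefactor 1/24 cancels exactly.\<close>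

lemma transvectant_2_quadratic_quartic:
  "transvectant 2 4 2 (quadratic_form a b c) (quartic_form p q r s t) =
     quadratic_form (a * r - 2 * b * q + c * p) (a * s - 2 * b * r + c * q)
       (a * t - 2 * b * s + c * r)"
  unfolding transvectant_2 by (simp add: scale_def form_defs pderiv_pCons fact_numeral field_simps)

text \<open>Swapping the arguments multiplies an r-th transvectant by (-1)^r, so for r = 2 the value
  is the same as in the opposite order.\<close>

lemma transvectant_2_quartic_quadratic:
  "transvectant 4 2 2 (quartic_form p q r s t) (quadratic_form a b c) =
     quadratic_form (a * r - 2 * b * q + c * p) (a * s - 2 * b * r + c * q)
       (a * t - 2 * b * s + c * r)"
  unfolding transvectant_2 by (simp add: scale_def form_defs pderiv_pCons fact_numeral field_simps)

lemmas form_simps = mult_linear_linear mult_quadratic_quadratic mult_quadratic_scalar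
  scale_quadratic scale_quartic add_quadratic minus_quadratic diff_quadratic add_quartic
  transvectant_quadratic_linear transvectant_1_quadratic_quadratic
  transvectant_2_quadratic_quadratic transvectant_2_quadratic_quartic
  transvectant_2_quartic_quadratic

theorem proposition3p2:
  fixes U V W a M N :: "'a::field_char_0 bipoly"
  assumes U: "binary_form 2 U"
    and V: "binary_form 2 V"
    and W: "binary_form 2 W"
    and a: "binary_form 1 a"
    and M: "M = scale (1/2) (transvectant 2 2 1 U W * V) + scale (1/2) (transvectant 2 2 1 U V * W)"
    and N: "N = - scale (1/2) (transvectant 2 4 2 U (V * W)) - scale (1/6) (U * transvectant 2 2 2 V W)"
  shows "transvectant 2 2 1 U (transvectant 2 1 1 V a * transvectant 2 1 1 W a)
       = transvectant 4 2 2 M (a^2) + transvectant 2 2 1 N (a^2)"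
proof -
  obtain u0 u1 u2 where U': "U = quadratic_form u0 u1 u2" using U by (rule binary_form_2_cases)
  obtain v0 v1 v2 where V': "V = quadratic_form v0 v1 v2" using V by (rule binary_form_2_cases)
  obtain w0 w1 w2 where W': "W = quadratic_form w0 w1 w2" using W by (rule binary_form_2_cases)
  obtain p q where a': "a = linear_form p q" using a by (rule binary_form_1_cases)
  show ?thesis
    \<comment> \<open>Writing the square of \<open>a\<close> as a product lets
      \<open>mult_linear_linear\<close> apply; then each side collapses to a single
      \<open>quadratic_form\<close>.\<close>
    unfolding M N U' V' W' a' power2_eq_square form_simps
    \<comment> \<open>Congruence leaves one polynomial identity per coefficient, with only numerals
      as denominators.\<close>
    by (rule arg_cong3[where f = quadratic_form]; simp add: field_simps)
qed

end
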